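(* Let $A(t,y,x)=\sum_{n\ge 0}t^n\sum_{\sigma\in\mathcal S_n(132)}y^{\mathrm{des}(\sigma)}x^{213\text{-mch}(\sigma)}$. Then $$A(t,y,x)=\frac{-\sqrt{t \left(2 y \left(x (t-1) t-t^2-1\right)+t y^2 (-xt+t+1)^2+t-2\right)+1}+(x-1) t^2 y (2 y-1)+t (y-1)+1}{2 t y ((x-1) ty+1)}.$$
   Context: $\mathcal S_n$ is the set of permutations of $\{1,\dots,n\}$ in one-line notation ($\mathcal S_0$ contains only the empty permutation, on which all statistics are $0$). For a word $w$ of distinct integers, $\mathrm{red}(w)$ replaces the $i$-th smallest letter by $i$. $\sigma\in\mathcal S_n$ avoids $\lambda\in\mathcal S_k$ (classical avoidance) if no (not necessarily contiguous) subsequence $\sigma_{i_1}\cdots\sigma_{i_k}$, $i_1<\dots<i_k$, has reduction $\lambda$; $\mathcal S_n(\lambda)$ is the set of such $\sigma$. $\gamma\text{-mch}(\sigma)$ is the number of $i$ with $\mathrm{red}(\sigma_i\sigma_{i+1}\cdots\sigma_{i+k-1})=\gamma$ for $\gamma\in\mathcal S_k$. $\mathrm{des}(\sigma)=|\{i:\sigma_i>\sigma_{i+1}\}|$. The identity is one of formal power series in $t$ over $\mathbb Q[x,y]$ (quotients in the fraction field); the square root is the power series in $t$ with constant term $1$. *)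

theory Defs
  imports
    "HOL-Library.Sublist"
    "HOL-Combinatorics.Multiset_Permutations"
    "HOL-Computational_Algebra.Computational_Algebra"
begin

(* Permutations of {1..n} in one-line notation are the lists in
   permutations_of_set {1..n}.  List positions are counted from 0. *)

definition red :: "nat list \<Rightarrow> nat list" where
  "red w = map (\<lambda>a. card {b \<in> set w. b \<le> a}) w"

definition avoids :: "nat list \<Rightarrow> nat list \<Rightarrow> bool" where
  "avoids \<sigma> p \<longleftrightarrow> \<not> (\<exists>u. subseq u \<sigma> \<and> red u = p)"

definition avoiders :: "nat \<Rightarrow> nat list \<Rightarrow> nat list set" where
  "avoiders n p = {\<sigma> \<in> permutations_of_set {1..n}. avoids \<sigma> p}"

definition des :: "nat list \<Rightarrow> nat" where
  "des \<sigma> = card {i. Suc i < length \<sigma> \<and> \<sigma> ! i > \<sigma> ! Suc i}"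

definition mch :: "nat list \<Rightarrow> nat list \<Rightarrow> nat" where
  "mch \<gamma> \<sigma> =
     card {i. i + length \<gamma> \<le> length \<sigma> \<and> red (take (length \<gamma>) (drop i \<sigma>)) = \<gamma>}"

(* The polynomial ring in x and y over the rationals is rat poly poly:
   x is the outer variable, y the inner one. *)

definition x_poly :: "rat poly poly" where
  "x_poly = [:0, 1:]"

definition y_poly :: "rat poly poly" where
  "y_poly = [:[:0, 1:]:]"

definition A_132_213 :: "rat poly poly fps" where
  "A_132_213 =
     Abs_fps (\<lambda>n. \<Sum>\<sigma>\<in>avoiders n [1, 3, 2]. y_poly ^ des \<sigma> * x_poly ^ mch [2, 1, 3] \<sigma>)"

(* The square root with constant term 1, unique over a domain of characteristic
   other than 2.  The library's fps_radical needs coefficients in a field. *)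

definition fps_sqrt :: "'a::idom fps \<Rightarrow> 'a fps" where
  "fps_sqrt f = (THE s. s ^ 2 = f \<and> fps_nth s 0 = 1)"

end

theory Submission
  imports Defs
begin

text \<open>A nonempty 132-avoiding permutation is \<open>L n R\<close> with \<open>n\<close> its largest letter, every letter of
  \<open>L\<close> above every letter of \<open>R\<close>, and \<open>L\<close>, \<open>R\<close> arbitrary 132-avoiders. The letter \<open>n\<close> contributes
  a descent unless \<open>R\<close> is empty, and a 213-match exactly when \<open>L\<close> ends in a descent. Let \<open>E\<close> be the
  generating function of the 132-avoiders ending in a descent and \<open>B = A + (x - 1) E\<close>. Then
  \<open>A = 1 + t B (1 + y (A - 1))\<close> and \<open>E = t B y (E + t)\<close>, which forces \<open>E = t y (A - 1)\<close> and leaves a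
  quadratic equation for \<open>A\<close>.\<close>

text \<open>Keeps the literals \<^term>\<open>[1, 3, 2]\<close> and \<^term>\<open>[2, 1, 3]\<close> in simp-normal form.\<close>
declare One_nat_def [simp del]

section \<open>Patterns of length three and avoidance of 132\<close>

text \<open>Each letter of \<open>red [a, b, c]\<close> is such a count; as a union of conditional
  singletons it can be evaluated by case distinction on the comparisons.\<close>

lemma card_le_triple:
  fixes a b c z :: nat
  shows "card {u \<in> {a, b, c}. u \<le> z} =
    card ((if a \<le> z then {a} else {}) \<union> (if b \<le> z then {b} else {}) \<union> (if c \<le> z then {c} else {}))"
  by (rule arg_cong[of _ _ card]) auto

lemma red_eq_132_iff: "red [a, b, c] = [1, 3, 2] \<longleftrightarrow> a < c \<and> c < b"
  unfolding red_def list.set list.map card_le_triple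
  by (auto simp: card_insert_if split: if_splits)

lemma red_eq_213_iff: "red [a, b, c] = [2, 1, 3] \<longleftrightarrow> b < a \<and> a < c"
  unfolding red_def list.set list.map card_le_triple
  by (auto simp: card_insert_if split: if_splits)

lemma length_red [simp]: "length (red w) = length w"
  by (simp add: red_def)

lemma set_subseq_subset: "subseq u w \<Longrightarrow> set u \<subseteq> set w"
  by (auto elim: list_emb_set)

lemma avoids_132_iff:
  "avoids \<sigma> [1, 3, 2] \<longleftrightarrow> (\<forall>a b c. subseq [a, b, c] \<sigma> \<longrightarrow> a < c \<longrightarrow> \<not> c < b)"
proof -
  have "(\<exists>u. subseq u \<sigma> \<and> red u = [1, 3, 2]) \<longleftrightarrow> (\<exists>a b c. subseq [a, b, c] \<sigma> \<and> a < c \<and> c < b)"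
    (is "?l \<longleftrightarrow> ?r")
  proof
    assume ?l
    then obtain u where u: "subseq u \<sigma>" "red u = [1, 3, 2]" by blast
    from arg_cong[OF u(2), of length] obtain a b c where "u = [a, b, c]"
      by (auto simp: numeral_3_eq_3 length_Suc_conv)
    with u show ?r using red_eq_132_iff by blast
  next
    assume ?r
    then show ?l using red_eq_132_iff by blast
  qed
  then show ?thesis by (auto simp: avoids_def)
qed

lemma avoids_subseq: "avoids \<sigma> p \<Longrightarrow> subseq \<tau> \<sigma> \<Longrightarrow> avoids \<tau> p"
  unfolding avoids_def using subseq_order.trans by blast

lemma avoids_132_map_add [simp]:
  "avoids (map (\<lambda>i. i + k) \<sigma>) [1, 3, 2] \<longleftrightarrow> avoids \<sigma> [1, 3, 2]"
proof
  assume *: "avoids (map (\<lambda>i. i + k) \<sigma>) [1, 3, 2]"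
  show "avoids \<sigma> [1, 3, 2]"
    unfolding avoids_132_iff
  proof (intro allI impI)
    fix a b c assume "subseq [a, b, c] \<sigma>" "a < c"
    from subseq_map[OF this(1), of "\<lambda>i. i + k"] * this(2) show "\<not> c < b"
      unfolding avoids_132_iff by force
  qed
next
  assume *: "avoids \<sigma> [1, 3, 2]"
  show "avoids (map (\<lambda>i. i + k) \<sigma>) [1, 3, 2]"
    unfolding avoids_132_iff
  proof (intro allI impI)
    fix a b c assume sub: "subseq [a, b, c] (map (\<lambda>i. i + k) \<sigma>)" and "a < c"
    \<comment> \<open>All three letters are at least \<open>k\<close>, so truncated subtraction of
      \<open>k\<close> preserves their order.\<close>
    have "set [a, b, c] \<subseteq> (\<lambda>i. i + k) ` set \<sigma>"
      using set_subseq_subset[OF sub] by simp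
    moreover have "subseq [a - k, b - k, c - k] \<sigma>"
      using subseq_map[OF sub, of "\<lambda>i. i - k"] by (simp add: comp_def)
    ultimately show "\<not> c < b"
      using * \<open>a < c\<close> unfolding avoids_132_iff by fastforce
  qed
qed

text \<open>A 132 pattern \<open>a b c\<close> cannot straddle the blocks: \<open>a = m\<close>
  contradicts \<open>a < c\<close>, \<open>c = m\<close> contradicts \<open>c < b\<close>, and
  \<open>a\<close> in \<open>L\<close> with \<open>c\<close> in \<open>R\<close> contradicts
  \<open>a < c\<close>. So it would lie entirely in \<open>L\<close> or entirely in
  \<open>R\<close>.\<close>

lemma avoids_132_append_Cons:
  assumes "avoids L [1, 3, 2]" "avoids R [1, 3, 2]"
    and m: "\<And>l. l \<in> set L \<Longrightarrow> l < m" "\<And>r. r \<in> set R \<Longrightarrow> r < m"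
    and LR: "\<And>l r. l \<in> set L \<Longrightarrow> r \<in> set R \<Longrightarrow> r < l"
  shows "avoids (L @ m # R) [1, 3, 2]"
  unfolding avoids_132_iff
proof (intro allI impI notI)
  fix a b c assume sub: "subseq [a, b, c] (L @ m # R)" and ac: "a < c" and cb: "c < b"
  from sub obtain us vs where split: "[a, b, c] = us @ vs" and us: "subseq us L"
    and vs: "subseq vs (m # R)" by (auto elim: subseq_appendE)
  note in_sets = set_subseq_subset[OF us] set_subseq_subset[OF vs]
  have "us = [] \<and> vs = [a, b, c] \<or> us = [a] \<and> vs = [b, c] \<or> us = [a, b] \<and> vs = [c] \<or>
    us = [a, b, c]"
    using split by (auto simp: Cons_eq_append_conv)
  then consider "us = []" "vs = [a, b, c]" | "us = [a]" "vs = [b, c]"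
    | "us = [a, b]" "vs = [c]" | "us = [a, b, c]"
    by blast
  then show False
  proof cases
    case 1
    with in_sets m ac have "a \<noteq> m" by fastforce
    with 1 vs have "subseq [a, b, c] R" by simp
    with assms(2) ac cb show False by (auto simp: avoids_132_iff)
  next
    case 2
    with vs cb m(2) have "c \<in> set R"
      by (auto split: if_splits dest: set_subseq_subset simp: subseq_singleton_left)
    with 2 in_sets LR ac show False by fastforce
  next
    case 3
    with in_sets m LR ac cb show False by fastforce
  next
    case 4
    with us assms(1) ac cb show False by (auto simp: avoids_132_iff)
  qed
qed

lemma mem_avoiders_iff:
  "\<sigma> \<in> avoiders n p \<longleftrightarrow> distinct \<sigma> \<and> set \<sigma> = {1..n} \<and> avoids \<sigma> p"
  by (auto simp: avoiders_def permutations_of_set_def)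

lemma finite_avoiders [simp]: "finite (avoiders n p)"
  by (simp add: avoiders_def)

lemma length_avoiders: "\<sigma> \<in> avoiders n p \<Longrightarrow> length \<sigma> = n"
  by (metis mem_avoiders_iff distinct_card card_atLeastAtMost diff_Suc_1)

lemma avoiders_0 [simp]: "avoiders 0 [1, 3, 2] = {[]}"
  by (auto simp: mem_avoiders_iff avoids_132_iff simp del: One_nat_def)

section \<open>Decomposition at the largest letter\<close>

text \<open>Both arguments are permutations of initial segments; the shift by
  \<open>length R\<close> lifts the left block exactly above the right one.\<close>

definition join :: "nat list \<Rightarrow> nat list \<Rightarrow> nat list" where
  "join L R = map (\<lambda>i. i + length R) L @ Suc (length L + length R) # R"

lemma join_mem_avoiders:
  assumes "L \<in> avoiders k [1, 3, 2]" "R \<in> avoiders j [1, 3, 2]"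
  shows "join L R \<in> avoiders (Suc (k + j)) [1, 3, 2]"
proof -
  have len: "length L = k" "length R = j" using assms by (auto dest: length_avoiders)
  have L: "distinct L" "set L = {1..k}" "avoids L [1, 3, 2]"
    and R: "distinct R" "set R = {1..j}" "avoids R [1, 3, 2]"
    using assms by (auto simp: mem_avoiders_iff)
  have "set (map (\<lambda>i. i + j) L) = {Suc j..j + k}"
    using L(2) image_add_atLeastAtMost'[of j 1 k] by (simp add: add.commute)
  moreover from this have "set (join L R) = {1..Suc (k + j)}"
    using R(2) by (auto simp: join_def len)
  moreover have "avoids (join L R) [1, 3, 2]"
    unfolding join_def len
    by (rule avoids_132_append_Cons) (use L R in \<open>auto simp flip: One_nat_def\<close>)
  moreover have "distinct (join L R)"
    using L(1,2) R(1,2) by (auto simp: join_def len distinct_map)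
  ultimately show ?thesis by (simp add: mem_avoiders_iff)
qed

text \<open>\<open>B\<close> is closed downwards: a number in \<open>{1..Max B}\<close> lies in
  \<open>A\<close> or \<open>B\<close>, but every element of \<open>A\<close> exceeds
  \<open>Max B\<close>. Hence \<open>B\<close> is an initial segment.\<close>

lemma lower_part_of_interval:
  fixes A B :: "nat set"
  assumes "A \<union> B = {1..n}" and "\<And>a b. a \<in> A \<Longrightarrow> b \<in> B \<Longrightarrow> b < a"
  shows "B = {1..card B}" "A = {Suc (card B)..n}"
proof -
  have fin: "finite B" using assms(1) by (metis finite_Un finite_atLeastAtMost)
  obtain m where m: "B = {1..m}"
  proof (cases "B = {}")
    case False
    define m where "m = Max B"
    have mB: "m \<in> B" using fin False by (simp add: m_def)
    have "{1..m} \<subseteq> B"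
    proof
      fix i assume "i \<in> {1..m}"
      moreover have "m \<le> n" using mB assms(1) by fastforce
      ultimately have "i \<in> A \<union> B" using assms(1) by simp
      with \<open>i \<in> {1..m}\<close> assms(2)[OF _ mB] show "i \<in> B" by fastforce
    qed
    moreover have "B \<subseteq> {1..m}" using fin assms(1) by (auto simp: m_def)
    ultimately show thesis using that by blast
  \<comment> \<open>The empty set is the segment \<open>{1..0}\<close>.\<close>
  qed (use that[of 0] in auto)
  then show "B = {1..card B}" by simp
  have "A \<inter> B = {}" using assms(2) by blast
  with assms(1) have "A = {1..n} - B" by blast
  then show "A = {Suc (card B)..n}" using m by auto
qed

lemma avoiders_joinE:
  assumes "\<sigma> \<in> avoiders (Suc n) [1, 3, 2]"
  obtains L R where "length L + length R = n" "\<sigma> = join L R"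
    "L \<in> avoiders (length L) [1, 3, 2]" "R \<in> avoiders (length R) [1, 3, 2]"
proof -
  have \<sigma>: "distinct \<sigma>" "set \<sigma> = {1..Suc n}" "avoids \<sigma> [1, 3, 2]"
    using assms by (auto simp: mem_avoiders_iff)
  from \<sigma>(2) have "Suc n \<in> set \<sigma>" by simp
  then obtain L R where split: "\<sigma> = L @ Suc n # R" by (meson split_list)
  have un: "set L \<union> set R = {1..n}"
  proof -
    have "set L \<union> set R = set \<sigma> - {Suc n}" using \<sigma>(1) by (auto simp: split)
    also have "\<dots> = {1..n}" unfolding \<sigma>(2) by auto
    finally show ?thesis .
  qed
  \<comment> \<open>Otherwise \<open>l\<close>, \<open>Suc n\<close>, \<open>r\<close> would form a
    132 pattern.\<close>
  have less: "r < l" if "l \<in> set L" "r \<in> set R" for l r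
  proof -
    have "subseq ([l] @ Suc n # [r]) (L @ Suc n # R)"
      by (rule list_emb_append_mono) (use that in \<open>simp_all add: subseq_singleton_left\<close>)
    then have "\<not> (l < r \<and> r < Suc n)"
      using \<sigma>(3) unfolding split avoids_132_iff by auto
    moreover have "r \<in> {1..n}" using that unfolding un[symmetric] by blast
    then have "r < Suc n" by simp
    moreover have "l \<noteq> r" using that \<sigma>(1) by (auto simp: split)
    ultimately show ?thesis by simp
  qed
  have cardR: "card (set R) = length R"
    using \<sigma>(1) by (simp add: split distinct_card)
  have R: "set R = {1..length R}" and L: "set L = {Suc (length R)..n}"
    using lower_part_of_interval[OF un less] by (simp_all add: cardR)
  have len: "length L + length R = n"
    using length_avoiders[OF assms] by (simp add: split)
  \<comment> \<open>This is the reduction of \<open>L\<close>: its letters fill the interval just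
    above \<open>length R\<close>.\<close>
  define L' where "L' = map (\<lambda>i. i - length R) L"
  have LL': "L = map (\<lambda>i. i + length R) L'"
    using L by (auto simp: L'_def intro!: map_idI[symmetric])
  have lenL: "length L' = length L" by (simp add: L'_def)
  have av: "avoids L [1, 3, 2]" "avoids R [1, 3, 2]"
    using avoids_subseq[OF \<sigma>(3)] by (auto simp: split intro: list_emb_append2 list_emb_prefix)
  show thesis
  proof (rule that[of L' R])
    show "length L' + length R = n" using len by (simp add: lenL)
    then show "\<sigma> = join L' R" by (simp add: join_def split flip: LL')
    show "R \<in> avoiders (length R) [1, 3, 2]"
      using \<sigma>(1) R av by (simp add: mem_avoiders_iff split)
    have "(\<lambda>i. i + length R) ` set L' = {Suc (length R)..length L + length R}"
      using L LL' len by (metis set_map)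
    also have "\<dots> = (\<lambda>i. i + length R) ` {1..length L}"
      using image_add_atLeastAtMost'[of "length R" 1 "length L"] by (simp add: add.commute)
    finally have "set L' = {1..length L}"
      by (subst (asm) inj_image_eq_iff) (auto simp: inj_def)
    moreover have "distinct L'" using \<sigma>(1) LL' by (auto simp: split distinct_map)
    moreover have "avoids L' [1, 3, 2]" using av(1) LL' by (metis avoids_132_map_add)
    ultimately show "L' \<in> avoiders (length L') [1, 3, 2]"
      by (simp add: mem_avoiders_iff lenL)
  qed
qed

lemma inj_on_join:
  "inj_on (\<lambda>(k, L, R). join L R)
     (SIGMA k:{..n}. avoiders k [1, 3, 2] \<times> avoiders (n - k) [1, 3, 2])"
proof (intro inj_onI, clarsimp)
  fix k L R k' L' R'
  assume k: "k \<le> n" "k' \<le> n" and LR: "L \<in> avoiders k [1, 3, 2]"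
    "R \<in> avoiders (n - k) [1, 3, 2]" "L' \<in> avoiders k' [1, 3, 2]"
    "R' \<in> avoiders (n - k') [1, 3, 2]" and eq: "join L R = join L' R'"
  have len: "length L = k" "length R = n - k" "length L' = k'" "length R' = n - k'"
    using LR by (auto dest: length_avoiders)
  have sets: "set L = {1..k}" "set R = {1..n - k}" "set L' = {1..k'}" "set R' = {1..n - k'}"
    using LR by (auto simp: mem_avoiders_iff)
  have eq': "map (\<lambda>i. i + (n - k)) L @ Suc n # R = map (\<lambda>i. i + (n - k')) L' @ Suc n # R'"
    using eq k by (simp add: join_def len)
  \<comment> \<open>The largest letter occurs only once on each side, so splitting there is
    unambiguous; the length of \<open>R\<close> then determines \<open>k\<close>.\<close>
  have "Suc n \<notin> set (map (\<lambda>i. i + (n - k)) L)" "Suc n \<notin> set R"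
    "Suc n \<notin> set (map (\<lambda>i. i + (n - k')) L')" "Suc n \<notin> set R'"
    using k by (auto simp: sets)
  then have "R = R'" "map (\<lambda>i. i + (n - k)) L = map (\<lambda>i. i + (n - k')) L'"
    using append_Cons_eq_iff eq' by metis+
  moreover from this k len have "k = k'" by (metis diff_diff_cancel)
  ultimately show "k = k' \<and> L = L' \<and> R = R'"
    by (auto dest: map_injective simp: inj_def)
qed

lemma bij_betw_join:
  "bij_betw (\<lambda>(k, L, R). join L R)
     (SIGMA k:{..n}. avoiders k [1, 3, 2] \<times> avoiders (n - k) [1, 3, 2])
     (avoiders (Suc n) [1, 3, 2])"
  unfolding bij_betw_def
proof (intro conjI inj_on_join equalityI subsetI)
  fix \<sigma> assume "\<sigma> \<in> avoiders (Suc n) [1, 3, 2]"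
  then obtain L R where "length L + length R = n" "\<sigma> = join L R"
    "L \<in> avoiders (length L) [1, 3, 2]" "R \<in> avoiders (length R) [1, 3, 2]"
    by (rule avoiders_joinE)
  then show "\<sigma> \<in> (\<lambda>(k, L, R). join L R) `
      (SIGMA k:{..n}. avoiders k [1, 3, 2] \<times> avoiders (n - k) [1, 3, 2])"
    by (intro image_eqI[of _ _ "(length L, L, R)"]) auto
next
  fix \<sigma> assume "\<sigma> \<in> (\<lambda>(k, L, R). join L R) `
      (SIGMA k:{..n}. avoiders k [1, 3, 2] \<times> avoiders (n - k) [1, 3, 2])"
  then show "\<sigma> \<in> avoiders (Suc n) [1, 3, 2]"
    using join_mem_avoiders by fastforce
qed

section \<open>Weighted generating functions and the product rule\<close>

definition avoiders_gf :: "(nat list \<Rightarrow> 'a::comm_ring_1) \<Rightarrow> 'a fps" where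
  "avoiders_gf w = Abs_fps (\<lambda>n. \<Sum>\<sigma>\<in>avoiders n [1, 3, 2]. w \<sigma>)"

text \<open>Summing over the bijection \<open>join\<close> gives a Cauchy product; the factor
  \<open>fps_X\<close> accounts for the largest letter and the constant for the empty
  permutation.\<close>

lemma avoiders_gf_join:
  assumes "\<And>k j L R. L \<in> avoiders k [1, 3, 2] \<Longrightarrow> R \<in> avoiders j [1, 3, 2] \<Longrightarrow>
    w (join L R) = f L * g R"
  shows "avoiders_gf w = fps_const (w []) + fps_X * avoiders_gf f * avoiders_gf g"
proof (rule fps_ext)
  fix n
  show "fps_nth (avoiders_gf w) n =
    fps_nth (fps_const (w []) + fps_X * avoiders_gf f * avoiders_gf g) n"
  proof (cases n)
    case 0
    then show ?thesis by (simp add: avoiders_gf_def flip: One_nat_def)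
  next
    case (Suc m)
    have "(\<Sum>\<sigma>\<in>avoiders (Suc m) [1, 3, 2]. w \<sigma>) =
      (\<Sum>(k, L, R)\<in>(SIGMA k:{..m}. avoiders k [1, 3, 2] \<times> avoiders (m - k) [1, 3, 2]).
        w (join L R))"
      by (subst sum.reindex_bij_betw[OF bij_betw_join, symmetric]) (simp add: case_prod_unfold)
    also have "\<dots> = (\<Sum>k\<le>m. \<Sum>(L, R)\<in>avoiders k [1, 3, 2] \<times> avoiders (m - k) [1, 3, 2].
        w (join L R))"
      by (subst sum.Sigma) (auto simp: case_prod_unfold)
    also have "\<dots> = (\<Sum>k\<le>m. \<Sum>(L, R)\<in>avoiders k [1, 3, 2] \<times> avoiders (m - k) [1, 3, 2].
        f L * g R)"
      by (intro sum.cong refl) (auto intro: assms)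
    also have "\<dots> = (\<Sum>k\<le>m. (\<Sum>L\<in>avoiders k [1, 3, 2]. f L) *
        (\<Sum>R\<in>avoiders (m - k) [1, 3, 2]. g R))"
      by (simp only: sum_product sum.cartesian_product)
    finally show ?thesis
      unfolding Suc mult.assoc
      by (simp add: avoiders_gf_def fps_mult_nth[of "Abs_fps _"] atLeast0AtMost)
  qed
qed

section \<open>Descents, 213-matches and final descents of a joined permutation\<close>

lemma des_Nil [simp]: "des [] = 0"
  by (simp add: des_def)

lemma des_Cons: "des (a # xs) = of_bool (xs \<noteq> [] \<and> hd xs < a) + des xs"
proof -
  have "{i. Suc i < length (a # xs) \<and> (a # xs) ! i > (a # xs) ! Suc i} =
    (if xs \<noteq> [] \<and> hd xs < a then {0} else {}) \<union>
    Suc ` {i. Suc i < length xs \<and> xs ! i > xs ! Suc i}" (is "?l = ?r")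
  proof (rule set_eqI)
    fix i show "i \<in> ?l \<longleftrightarrow> i \<in> ?r"
      by (cases i) (auto simp: hd_conv_nth)
  qed
  moreover have "finite {i. Suc i < length xs \<and> xs ! i > xs ! Suc i}"
    by (rule finite_subset[of _ "{..length xs}"]) auto
  ultimately show ?thesis
    by (simp add: des_def card_insert_if card_image image_iff)
qed

abbreviation mch213 :: "nat list \<Rightarrow> nat" where
  "mch213 \<equiv> mch [2, 1, 3]"

lemma mch213_Nil [simp]: "mch213 [] = 0"
  by (simp add: mch_def)

text \<open>The window at position 0 is tested separately; all other windows are those of
  \<open>xs\<close> moved by one position.\<close>

lemma mch213_Cons:
  "mch213 (a # xs) = of_bool (2 \<le> length xs \<and> xs ! 0 < a \<and> a < xs ! 1) + mch213 xs"
proof -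
  let ?M = "\<lambda>xs. {i. i + 3 \<le> length xs \<and> red (take 3 (drop i xs)) = [2, 1, 3]}"
  have 0: "0 \<in> ?M (a # xs) \<longleftrightarrow> 2 \<le> length xs \<and> xs ! 0 < a \<and> a < xs ! 1"
  proof (cases "2 \<le> length xs")
    case True
    then obtain b c ys where "xs = b # c # ys"
      by (metis Suc_le_length_iff numeral_2_eq_2)
    then show ?thesis using red_eq_213_iff[of a b c] by simp
  qed simp
  have "?M (a # xs) = (if 0 \<in> ?M (a # xs) then {0} else {}) \<union> Suc ` ?M xs" (is "_ = ?r")
  proof (rule set_eqI)
    fix i show "i \<in> ?M (a # xs) \<longleftrightarrow> i \<in> ?r"
      by (cases i) auto
  qed
  moreover have "finite (?M xs)"
    by (rule finite_subset[of _ "{..length xs}"]) auto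
  ultimately have "card (?M (a # xs)) = of_bool (0 \<in> ?M (a # xs)) + card (?M xs)"
    by (smt (verit) Suc_not_Zero Un_commute Un_insert_left card_image card_insert_disjoint
        finite_imageI image_iff inj_Suc of_bool_eq sup_bot_left plus_1_eq_Suc add_0)
  moreover have "length [2, 1, 3 :: nat] = 3" by simp
  ultimately show ?thesis unfolding 0 mch_def by metis
qed

lemma mch213_simps [simp]:
  "mch213 [a] = 0"
  "mch213 [a, b] = 0"
  "mch213 (a # b # c # xs) = of_bool (b < a \<and> a < c) + mch213 (b # c # xs)"
  by (simp_all add: mch213_Cons nth_Cons')

text \<open>The condition on the left block under which the largest letter completes a 213-match.
  Peeling from the front makes the induction rule follow the windows of length three.\<close>

fun ends_desc :: "nat list \<Rightarrow> bool" where
  "ends_desc (a # b # c # xs) = ends_desc (b # c # xs)"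
| "ends_desc [a, b] = (b < a)"
| "ends_desc _ = False"

lemma des_append_Cons:
  assumes "\<And>l. l \<in> set L \<Longrightarrow> l < m" "\<And>r. r \<in> set R \<Longrightarrow> r < m"
  shows "des (L @ m # R) = des L + des R + of_bool (R \<noteq> [])"
  using assms
proof (induction L)
  case Nil
  then show ?case by (auto simp: des_Cons)
next
  case (Cons a L)
  then show ?case by (cases L) (auto simp: des_Cons)
qed

text \<open>In a matching window through \<open>m\<close>, the maximum \<open>m\<close> must play
  the 3 and so stand last. Such a window consists of the last two letters of \<open>L\<close> and
  \<open>m\<close>, and it matches exactly when those two descend.\<close>

lemma mch213_append_Cons:
  assumes "\<And>l. l \<in> set L \<Longrightarrow> l < m" "\<And>r. r \<in> set R \<Longrightarrow> r < m"
  shows "mch213 (L @ m # R) = mch213 L + mch213 R + of_bool (ends_desc L)"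
  using assms
proof (induction L rule: ends_desc.induct)
  case (2 a b)
  then have "a < m" "b < m" "\<forall>r\<in>set R. r < m" by auto
  then show ?case by (cases R rule: ends_desc.cases) auto
next
  case ("3_1")
  then have "\<forall>r\<in>set R. r < m" by auto
  then show ?case by (cases R rule: ends_desc.cases) auto
next
  case ("3_2" a)
  then have "a < m" "\<forall>r\<in>set R. r < m" by auto
  then show ?case by (cases R rule: ends_desc.cases) auto
qed auto

text \<open>If \<open>R\<close> is empty, the list ends in an ascent to \<open>m\<close> or is
  \<open>[m]\<close>; if \<open>R\<close> has one letter, the final pair descends from
  \<open>m\<close>; otherwise the final pair lies in \<open>R\<close>.\<close>

lemma ends_desc_append_Cons:
  assumes "\<And>l. l \<in> set L \<Longrightarrow> l < m" "\<And>r. r \<in> set R \<Longrightarrow> r < m"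
  shows "ends_desc (L @ m # R) \<longleftrightarrow> length R = 1 \<or> ends_desc R"
  using assms
proof (induction L rule: ends_desc.induct)
  case (2 a b)
  then have "b < m" "\<forall>r\<in>set R. r < m" by auto
  then show ?case by (cases R rule: ends_desc.cases) auto
next
  case ("3_1")
  then have "\<forall>r\<in>set R. r < m" by auto
  then show ?case by (cases R rule: ends_desc.cases) auto
next
  case ("3_2" a)
  then have "a < m" "\<forall>r\<in>set R. r < m" by auto
  then show ?case by (cases R rule: ends_desc.cases) auto
qed auto

lemma map_add_statistics [simp]:
  "des (map (\<lambda>i. i + k) L) = des L"
  "mch213 (map (\<lambda>i. i + k) L) = mch213 L"
  "ends_desc (map (\<lambda>i. i + k) L) = ends_desc L"
proof -
  show "des (map (\<lambda>i. i + k) L) = des L"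
    by (induction L) (auto simp: des_Cons hd_map)
  show "mch213 (map (\<lambda>i. i + k) L) = mch213 L"
    by (induction L rule: ends_desc.induct) auto
  show "ends_desc (map (\<lambda>i. i + k) L) = ends_desc L"
    by (induction L rule: ends_desc.induct) auto
qed

lemma join_statistics:
  assumes "L \<in> avoiders k [1, 3, 2]" "R \<in> avoiders j [1, 3, 2]"
  shows "des (join L R) = des L + des R + of_bool (R \<noteq> [])"
    "mch213 (join L R) = mch213 L + mch213 R + of_bool (ends_desc L)"
    "ends_desc (join L R) \<longleftrightarrow> length R = 1 \<or> ends_desc R"
proof -
  let ?L = "map (\<lambda>i. i + length R) L" and ?m = "Suc (length L + length R)"
  have "set L = {1..length L}" "set R = {1..length R}"
    using assms length_avoiders by (auto simp: mem_avoiders_iff)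
  then have bounds: "\<And>l. l \<in> set ?L \<Longrightarrow> l < ?m" "\<And>r. r \<in> set R \<Longrightarrow> r < ?m"
    by auto
  show "des (join L R) = des L + des R + of_bool (R \<noteq> [])"
    using des_append_Cons[of ?L ?m R, OF bounds] by (simp add: join_def)
  show "mch213 (join L R) = mch213 L + mch213 R + of_bool (ends_desc L)"
    using mch213_append_Cons[of ?L ?m R, OF bounds] by (simp add: join_def)
  show "ends_desc (join L R) \<longleftrightarrow> length R = 1 \<or> ends_desc R"
    using ends_desc_append_Cons[of ?L ?m R, OF bounds] by (simp add: join_def)
qed

section \<open>Linearity and the generating functions of the indicator weights\<close>

lemma avoiders_gf_add: "avoiders_gf (\<lambda>\<sigma>. f \<sigma> + g \<sigma>) = avoiders_gf f + avoiders_gf g"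
  by (rule fps_ext) (simp add: avoiders_gf_def sum.distrib)

lemma avoiders_gf_cmult: "avoiders_gf (\<lambda>\<sigma>. c * f \<sigma>) = fps_const c * avoiders_gf f"
  by (rule fps_ext) (simp add: avoiders_gf_def sum_distrib_left)

lemma avoiders_gf_delta_Nil: "avoiders_gf (\<lambda>\<sigma>. of_bool (\<sigma> = [])) = 1"
proof (rule fps_ext)
  fix n
  have "(\<Sum>\<sigma>\<in>avoiders n [1, 3, 2]. of_bool (\<sigma> = []) :: 'a) = of_bool (n = 0)"
    by (cases "n = 0") (auto simp: mem_avoiders_iff intro!: sum.neutral simp flip: One_nat_def)
  then show "fps_nth (avoiders_gf (\<lambda>\<sigma>. of_bool (\<sigma> = [])) :: 'a fps) n = fps_nth 1 n"
    by (simp add: avoiders_gf_def)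
qed

lemma avoiders_1: "avoiders 1 [1, 3, 2] = {[1]}"
proof -
  have "avoids [1] [1, 3, 2]"
    by (auto simp: avoids_132_iff dest: list_emb_length)
  then show ?thesis
    by (auto simp: avoiders_def permutations_of_set_singleton)
qed

lemma avoiders_gf_delta_singleton: "avoiders_gf (\<lambda>\<sigma>. of_bool (length \<sigma> = 1)) = fps_X"
proof (rule fps_ext)
  fix n
  have "(\<Sum>\<sigma>\<in>avoiders n [1, 3, 2]. of_bool (length \<sigma> = 1) :: 'a) = of_bool (n = 1)"
  proof (cases "n = 1")
    case True
    then show ?thesis by (simp only: avoiders_1) simp
  next
    case False
    then show ?thesis using length_avoiders by (auto intro!: sum.neutral)
  qed
  then show "fps_nth (avoiders_gf (\<lambda>\<sigma>. of_bool (length \<sigma> = 1)) :: 'a fps) n = fps_nth fps_X n"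
    by (simp add: avoiders_gf_def fps_X_def)
qed


section \<open>Weights of joined permutations and the functional equations\<close>

definition wt :: "'a::comm_ring_1 \<Rightarrow> 'a \<Rightarrow> nat list \<Rightarrow> 'a" where
  "wt y x \<sigma> = y ^ des \<sigma> * x ^ mch213 \<sigma>"

lemma wt_short: "length \<sigma> \<le> 1 \<Longrightarrow> wt y x \<sigma> = 1"
  by (cases \<sigma>) (auto simp: wt_def des_Cons mch213_Cons)

text \<open>The case distinctions are encoded linearly: the left factor is \<open>wt y x L\<close>,
  times \<open>x\<close> if \<open>L\<close> ends in a descent; the right factor is
  \<open>y * wt y x R\<close>, or 1 for empty \<open>R\<close>. In this form
  \<open>avoiders_gf\<close> can be applied termwise.\<close>

lemma wt_join:
  assumes "L \<in> avoiders k [1, 3, 2]" "R \<in> avoiders j [1, 3, 2]"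
  shows "wt y x (join L R) =
    (wt y x L + (x - 1) * (of_bool (ends_desc L) * wt y x L)) *
    (y * wt y x R + (1 - y) * of_bool (R = []))"
  using join_statistics[OF assms]
  by (cases "R = []"; cases "ends_desc L") (auto simp: wt_def power_add algebra_simps)

lemma ends_desc_wt_join:
  assumes "L \<in> avoiders k [1, 3, 2]" "R \<in> avoiders j [1, 3, 2]"
  shows "of_bool (ends_desc (join L R)) * wt y x (join L R) =
    (wt y x L + (x - 1) * (of_bool (ends_desc L) * wt y x L)) *
    (y * (of_bool (ends_desc R) * wt y x R + of_bool (length R = 1)))"
proof (cases "length R = 1")
  case True
  \<comment> \<open>The two indicators for \<open>R\<close> are mutually exclusive, so their sum
    counts each permutation once; a one-letter \<open>R\<close> has weight 1.\<close>
  moreover from this have "\<not> ends_desc R" by (cases R rule: ends_desc.cases) auto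
  moreover from True have "R \<noteq> []" by auto
  ultimately show ?thesis
    using join_statistics(3)[OF assms]
    by (auto simp: wt_join[OF assms] wt_short)
next
  case False
  moreover have "R \<noteq> []" if "ends_desc R" using that by auto
  ultimately show ?thesis
    using join_statistics(3)[OF assms]
    by (auto simp: wt_join[OF assms])
qed

lemma avoiders_gf_wt_equations:
  fixes y x :: "'a::comm_ring_1"
  defines "A \<equiv> avoiders_gf (wt y x)"
    and "E \<equiv> avoiders_gf (\<lambda>\<sigma>. of_bool (ends_desc \<sigma>) * wt y x \<sigma>)"
    and "c \<equiv> fps_const x" and "d \<equiv> fps_const y"
  shows "A = 1 + fps_X * (A + (c - 1) * E) * (d * A + (1 - d))"
    and "E = fps_X * (A + (c - 1) * E) * (d * (E + fps_X))"
proof -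
  let ?f = "\<lambda>\<sigma>. wt y x \<sigma> + (x - 1) * (of_bool (ends_desc \<sigma>) * wt y x \<sigma>)"
  have f: "avoiders_gf ?f = A + (c - 1) * E"
    by (simp only: avoiders_gf_add avoiders_gf_cmult A_def E_def c_def)
      (simp flip: fps_const_sub)
  let ?g = "\<lambda>\<sigma>. y * wt y x \<sigma> + (1 - y) * of_bool (\<sigma> = [])"
  have "avoiders_gf ?g = d * A + (1 - d)"
    by (simp only: avoiders_gf_add avoiders_gf_cmult avoiders_gf_delta_Nil A_def d_def)
      (simp flip: fps_const_sub)
  moreover have "avoiders_gf (wt y x) =
    fps_const (wt y x []) + fps_X * avoiders_gf ?f * avoiders_gf ?g"
    by (rule avoiders_gf_join) (rule wt_join)
  ultimately show "A = 1 + fps_X * (A + (c - 1) * E) * (d * A + (1 - d))"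
    by (simp add: f wt_short flip: A_def)
  let ?e = "\<lambda>\<sigma>. of_bool (ends_desc \<sigma>) * wt y x \<sigma>"
  let ?h = "\<lambda>\<sigma>. y * (?e \<sigma> + of_bool (length \<sigma> = 1))"
  have "avoiders_gf ?h = d * (E + fps_X)"
    by (simp only: avoiders_gf_add avoiders_gf_cmult avoiders_gf_delta_singleton E_def d_def)
  \<comment> \<open>Here \<open>?e []\<close> is 0, since the empty permutation has no final
    descent; hence no constant appears in the equation for \<open>E\<close>.\<close>
  moreover have "avoiders_gf ?e = fps_const (?e []) + fps_X * avoiders_gf ?f * avoiders_gf ?h"
    by (rule avoiders_gf_join) (rule ends_desc_wt_join)
  ultimately show "E = fps_X * (A + (c - 1) * E) * (d * (E + fps_X))"
    by (simp only: f flip: E_def) simp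
qed

section \<open>Square roots of power series and solution of the quadratic\<close>

text \<open>In a domain a square determines its root up to sign, and the constant term 1 rules out
  the opposite sign because \<open>2\<close> is nonzero.\<close>

lemma fps_sqrt_eqI:
  fixes s :: "'a::idom fps"
  assumes "s ^ 2 = f" "fps_nth s 0 = 1" "(2 :: 'a) \<noteq> 0"
  shows "fps_sqrt f = s"
  unfolding fps_sqrt_def
proof (rule the_equality)
  fix r assume r: "r ^ 2 = f \<and> fps_nth r 0 = 1"
  then have "r = s \<or> r = - s" using assms(1) by (simp flip: power2_eq_iff)
  moreover have "r \<noteq> - s"
  proof
    assume "r = - s"
    then have "1 = - (1 :: 'a)" using r assms(2) by (metis fps_neg_nth)
    then have "1 + 1 = (0 :: 'a)" by (simp add: eq_neg_iff_add_eq_0)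
    with assms(3) show False by simp
  qed
  ultimately show "r = s" by blast
qed (use assms in simp)

text \<open>Put \<open>B = A + (x - 1) * E\<close>. Multiplying the first equation, as
  \<open>A - 1 = t * B * (1 + y * (A - 1))\<close>, by \<open>t * y\<close> shows that
  \<open>t * y * (A - 1)\<close> satisfies the same linear equation
  \<open>Z = t * B * y * (Z + t)\<close> as \<open>E\<close>. The difference of the two solutions is
  annihilated by the nonzero \<open>1 - t * y * B\<close>, so they agree.\<close>

lemma quadratic_of_system:
  fixes t x y A E :: "'a::idom"
  assumes A: "A = 1 + t * (A + (x - 1) * E) * (y * A + (1 - y))"
    and E: "E = t * (A + (x - 1) * E) * (y * (E + t))"
    and nz: "1 - t * y * (A + (x - 1) * E) \<noteq> 0"
  shows "A - 1 = t * (A + (x - 1) * t * y * (A - 1)) * (1 + y * (A - 1))"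
proof -
  define B where "B = A + (x - 1) * E"
  have A': "A = 1 + t * B * (y * A + (1 - y))" and E': "E = t * B * (y * (E + t))"
    using A E by (simp_all add: B_def)
  have "(1 - t * y * B) * (E - t * y * (A - 1)) = 0" using A' E' by algebra
  then have "E = t * y * (A - 1)" using nz by (simp add: B_def)
  then show ?thesis using A by algebra
qed

theorem theorem5:
  shows "let t = fps_X :: rat poly poly fps;
             x = fps_const x_poly;
             y = fps_const y_poly
         in Fraction_Field.Fract A_132_213 1 =
            Fraction_Field.Fract
              (- fps_sqrt (t * (2 * y * (x * (t - 1) * t - t ^ 2 - 1)
                                + t * y ^ 2 * (- x * t + t + 1) ^ 2 + t - 2) + 1)
               + (x - 1) * t ^ 2 * y * (2 * y - 1) + t * (y - 1) + 1)
              (2 * t * y * ((x - 1) * t * y + 1))"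
proof -
  define t where "t = (fps_X :: rat poly poly fps)"
  define x where "x = fps_const x_poly"
  define y where "y = fps_const y_poly"
  define A where "A = A_132_213"
  define E where "E = avoiders_gf (\<lambda>\<sigma>. of_bool (ends_desc \<sigma>) * wt y_poly x_poly \<sigma>)"
  \<comment> \<open>Once \<open>E = t * y * (A - 1)\<close> is substituted,
    \<open>(x - 1) * E\<close> becomes \<open>c * (A - 1)\<close>.\<close>
  define c where "c = (x - 1) * t * y"
  have A_gf: "A = avoiders_gf (wt y_poly x_poly)"
    by (simp add: A_def A_132_213_def avoiders_gf_def wt_def)
  have t0: "fps_nth t 0 = 0"
    by (simp add: t_def)
  have quad: "A - 1 = t * (A + c * (A - 1)) * (1 + y * (A - 1))"
    unfolding c_def
  proof (rule quadratic_of_system)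
    show "A = 1 + t * (A + (x - 1) * E) * (y * A + (1 - y))"
      "E = t * (A + (x - 1) * E) * (y * (E + t))"
      using avoiders_gf_wt_equations[of y_poly x_poly]
      by (simp_all only: A_gf E_def t_def x_def y_def)
    have "fps_nth (1 - t * y * (A + (x - 1) * E)) 0 = 1" by (simp add: t0)
    then show "1 - t * y * (A + (x - 1) * E) \<noteq> 0" by (metis fps_zero_nth zero_neq_one)
  qed
  \<comment> \<open>With \<open>u = A - 1\<close>, \<open>quad\<close> reads
    \<open>t*y*(1+c)*u^2 - (1 - t*(1+c+y))*u + t = 0\<close>. \<open>S\<close> is minus the
    derivative of the left side at \<open>u\<close>, so \<open>S ^ 2\<close> is the
    discriminant.\<close>
  define S where "S = 1 - t * (1 + c + y) - 2 * t * y * (1 + c) * (A - 1)"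
  have sqrt: "fps_sqrt (t * (2 * y * (x * (t - 1) * t - t ^ 2 - 1)
      + t * y ^ 2 * (- x * t + t + 1) ^ 2 + t - 2) + 1) = S"
  proof (rule fps_sqrt_eqI)
    show "S ^ 2 = t * (2 * y * (x * (t - 1) * t - t ^ 2 - 1)
      + t * y ^ 2 * (- x * t + t + 1) ^ 2 + t - 2) + 1"
      using quad unfolding S_def c_def by algebra
    show "fps_nth S 0 = 1" by (simp add: S_def t0)
  qed simp
  \<comment> \<open>The denominator is \<open>2 * t * y * (c + 1)\<close>; its last factor is
    nonzero by its constant term.\<close>
  have "fps_nth (c + 1) 0 = 1" by (simp add: c_def t0)
  then have "c + 1 \<noteq> 0" by (metis fps_zero_nth zero_neq_one)
  moreover have "y \<noteq> 0" "t \<noteq> 0" by (simp_all add: y_def y_poly_def t_def)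
  ultimately have D: "2 * t * y * ((x - 1) * t * y + 1) \<noteq> 0" by (simp add: c_def)
  \<comment> \<open>The definition of \<open>S\<close> is linear in \<open>A\<close>; solving it for
    \<open>A\<close> gives the claimed quotient in cross-multiplied form.\<close>
  have "A * (2 * t * y * ((x - 1) * t * y + 1)) =
    - S + (x - 1) * t ^ 2 * y * (2 * y - 1) + t * (y - 1) + 1"
    unfolding S_def c_def by algebra
  then show ?thesis
    unfolding Let_def using D sqrt
    by (simp add: eq_fract A_def t_def x_def y_def)
qed

end
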